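(* Let $p>0$ and $n\geq 4p$ be integers. Then there exists a globally simple integer Heffter array $H(n;4p)$.
   Context: A Heffter array $H(n;k)$ is an $n\times n$ array of integers (some cells may be empty) such that: each row and each column contains exactly $k$ filled cells; the entries in every row and every column sum to $0$ modulo $2nk+1$; and for each integer $1\leq x\leq nk$, either $x$ or $-x$ appears in the array. It is an integer Heffter array if every row sum and every column sum is $0$ in $\mathbb{Z}$. Rows and columns are indexed by $0,1,\dots,n-1$. The natural ordering of a row lists its filled cells from left to right (increasing column index), and the natural ordering of a column lists its filled cells from top to bottom (increasing row index). The array is globally simple if, for every row and every column, writing its entries in natural order as $a_0,a_1,\dots,a_{k-1}$, the partial sums $\sum_{j=0}^{i}a_j$ for $i=0,\dots,k-1$ are pairwise distinct modulo $2nk+1$. *)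

theory Defs
  imports Main "HOL-Number_Theory.Cong"
begin

text \<open>
  A partially filled array is a function from (row, column) to entries, with \<open>None\<close> for an
  empty cell; an array of side \<open>n\<close> has rows and columns \<open>0, \<dots>, n - 1\<close>, and values of the
  function at other arguments play no role.
\<close>

type_synonym parray = "nat \<Rightarrow> nat \<Rightarrow> int option"

text \<open>
  \<open>map_filter\<close> drops the empty cells, so these lists are the rows and columns in their natural
  ordering.
\<close>

definition row_entries :: "nat \<Rightarrow> parray \<Rightarrow> nat \<Rightarrow> int list" where
  "row_entries n A r = List.map_filter (\<lambda>c. A r c) [0..<n]"

definition col_entries :: "nat \<Rightarrow> parray \<Rightarrow> nat \<Rightarrow> int list" where
  "col_entries n A c = List.map_filter (\<lambda>r. A r c) [0..<n]"

definition appears_in :: "nat \<Rightarrow> parray \<Rightarrow> int \<Rightarrow> bool" where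
  "appears_in n A x \<longleftrightarrow> (\<exists>r<n. \<exists>c<n. A r c = Some x)"

text \<open>
  In the last clause the disjunction may be read inclusively: there are only \<open>n * k\<close> filled
  cells, so \<open>x\<close> and \<open>- x\<close> cannot both appear, and no entry is repeated.
\<close>

definition heffter_array :: "nat \<Rightarrow> nat \<Rightarrow> parray \<Rightarrow> bool" where
  "heffter_array n k A \<longleftrightarrow>
     (\<forall>r<n. card {c. c < n \<and> A r c \<noteq> None} = k) \<and>
     (\<forall>c<n. card {r. r < n \<and> A r c \<noteq> None} = k) \<and>
     (\<forall>r<n. [sum_list (row_entries n A r) = 0] (mod (2 * int n * int k + 1))) \<and>
     (\<forall>c<n. [sum_list (col_entries n A c) = 0] (mod (2 * int n * int k + 1))) \<and>
     (\<forall>x::int. 1 \<le> x \<and> x \<le> int n * int k \<longrightarrow> appears_in n A x \<or> appears_in n A (- x))"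

definition integer_heffter_array :: "nat \<Rightarrow> nat \<Rightarrow> parray \<Rightarrow> bool" where
  "integer_heffter_array n k A \<longleftrightarrow>
     heffter_array n k A \<and>
     (\<forall>r<n. sum_list (row_entries n A r) = 0) \<and>
     (\<forall>c<n. sum_list (col_entries n A c) = 0)"

definition partial_sums_distinct_mod :: "int \<Rightarrow> int list \<Rightarrow> bool" where
  "partial_sums_distinct_mod m as \<longleftrightarrow>
     (\<forall>i<length as. \<forall>i'<length as. i \<noteq> i' \<longrightarrow>
        \<not> [(\<Sum>j\<le>i. as ! j) = (\<Sum>j\<le>i'. as ! j)] (mod m))"

definition globally_simple :: "nat \<Rightarrow> nat \<Rightarrow> parray \<Rightarrow> bool" where
  "globally_simple n k A \<longleftrightarrow>
     (\<forall>r<n. partial_sums_distinct_mod (2 * int n * int k + 1) (row_entries n A r)) \<and>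
     (\<forall>c<n. partial_sums_distinct_mod (2 * int n * int k + 1) (col_entries n A c))"

end

theory Submission imports Defs begin

text \<open>
  Fill the cells with \<open>(r - c) mod n = d < 4 * p\<close>. A line then reads its diagonals in cyclic order, up
  to reversal, and for a list with sum zero neither rotation nor reversal affects whether the
  partial sums are distinct. Diagonal \<open>d\<close> carries the absolute values \<open>n * b + 1, \<dots>, n * b + n\<close>,
  \<open>b = base p d\<close>, with signs \<open>+ - - +\<close> repeated, shifted so that two diagonals \<open>2 * j, 2 * j + 1\<close>
  add up to a constant along every column, and along every row up to an error that the other
  pair of the block of four cancels. The bases of a pair contribute \<open>-1\<close> (in units of \<open>n\<close>), except
  those of the last pair, \<open>0\<close> and \<open>2 * p - 1\<close>, which bring the sum back to \<open>0\<close>. So the sums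
  after complete pairs descend \<open>-1, -2, \<dots>\<close>; the sums inside a positive pair lie above all of these
  and those inside a negative pair below (with a borderline case in the last pair), in disjoint
  intervals of length \<open>n\<close>. All of them fit in a window shorter than the modulus.
\<close>

section \<open>Partial sums of zero-sum lists\<close>

lemma sum_nth_atMost:
  fixes as :: "int list"
  assumes "i < length as"
  shows "(\<Sum>j\<le>i. as ! j) = sum_list (take (Suc i) as)"
  using assms by (simp add: sum_list_sum_nth atLeast0AtMost atLeastLessThanSuc_atLeastAtMost min_absorb2)

text \<open>A difference of two partial sums is the sum of a segment. Stated through proper
  segments, the condition visibly survives reversal and rotation.\<close>

lemma partial_sums_distinct_mod_iff:
  assumes "m dvd sum_list as"
  shows "partial_sums_distinct_mod m as \<longleftrightarrow>
    (\<forall>xs ys zs. as = xs @ ys @ zs \<and> ys \<noteq> [] \<and> xs @ zs \<noteq> [] \<longrightarrow> \<not> m dvd sum_list ys)"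
proof
  assume psd: "partial_sums_distinct_mod m as"
  have inner: "\<not> m dvd sum_list ys" if "as = xs @ ys @ zs" "ys \<noteq> []" "xs \<noteq> []" for xs ys zs
  proof -
    define i i' where "i = length xs - 1" and "i' = length xs + length ys - 1"
    have "Suc i = length xs" "Suc i' = length xs + length ys" "i \<noteq> i'"
      using that by (auto simp: i_def i'_def neq_Nil_conv)
    moreover have "i < length as" "i' < length as"
      using that calculation by auto
    ultimately have "\<not> [sum_list xs = sum_list (xs @ ys)] (mod m)"
      using psd that unfolding partial_sums_distinct_mod_def by (metis append.assoc append_eq_conv_conj length_append sum_nth_atMost)
    then show ?thesis
      by (simp add: cong_iff_dvd_diff)
  qed
  show "\<forall>xs ys zs. as = xs @ ys @ zs \<and> ys \<noteq> [] \<and> xs @ zs \<noteq> [] \<longrightarrow> \<not> m dvd sum_list ys"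
  proof (intro allI impI, elim conjE)
    fix xs ys zs assume as: "as = xs @ ys @ zs" "ys \<noteq> []" "xs @ zs \<noteq> []"
    show "\<not> m dvd sum_list ys"
    \<comment> \<open>A prefix is not a difference of two listed partial sums; as the total vanishes
      modulo \<open>m\<close>, its complement \<open>zs\<close> stands in for it.\<close>
    proof (cases "xs = []")
      case True
      have "\<not> m dvd sum_list zs"
        using inner[of ys zs "[]"] as True by simp
      then show ?thesis
        using assms as True dvd_add_left_iff[of m "sum_list zs" "sum_list ys"] dvd_add_right_iff[of m "sum_list ys" "sum_list zs"] by auto
    next
      case False
      then show ?thesis using inner as by blast
    qed
  qed
next
  assume no_zero: "\<forall>xs ys zs. as = xs @ ys @ zs \<and> ys \<noteq> [] \<and> xs @ zs \<noteq> [] \<longrightarrow> \<not> m dvd sum_list ys"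
  have "\<not> [(\<Sum>j\<le>i. as ! j) = (\<Sum>j\<le>i'. as ! j)] (mod m)" if "i < i'" "i' < length as" for i i'
  proof -
    define xs ys where "xs = take (Suc i) as" and "ys = drop (Suc i) (take (Suc i') as)"
    have xs_ys: "take (Suc i') as = xs @ ys"
      using that unfolding xs_def ys_def
      by (metis Suc_le_mono append_take_drop_id less_imp_le_nat min.absorb1 take_take)
    then have "as = xs @ ys @ drop (Suc i') as"
      by (metis append.assoc append_take_drop_id)
    moreover have "ys \<noteq> []" "xs \<noteq> []"
      using that by (auto simp: xs_def ys_def)
    ultimately have "\<not> m dvd sum_list ys"
      using no_zero by blast
    then show ?thesis
      using that xs_ys by (simp add: sum_nth_atMost cong_iff_dvd_diff xs_def[symmetric] del: take_Suc)
  qed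
  then show "partial_sums_distinct_mod m as"
    unfolding partial_sums_distinct_mod_def by (metis cong_sym linorder_neqE_nat)
qed

lemma partial_sums_distinct_mod_rev:
  assumes "m dvd sum_list as" "partial_sums_distinct_mod m as"
  shows "partial_sums_distinct_mod m (rev as)"
proof -
  have "\<not> m dvd sum_list ys" if "rev as = xs @ ys @ zs" "ys \<noteq> []" "xs @ zs \<noteq> []" for xs ys zs
  proof -
    have "as = rev zs @ rev ys @ rev xs"
      using that(1) by (metis append.assoc rev_append rev_rev_ident)
    then show ?thesis
      using assms that(2,3) partial_sums_distinct_mod_iff[of m as]
      by (metis Nil_is_append_conv rev_is_Nil_conv sum_list_rev)
  qed
  then show ?thesis
    using assms(1) by (subst partial_sums_distinct_mod_iff) auto
qed

lemma partial_sums_distinct_mod_append_commute: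
  assumes dvd: "m dvd sum_list (us @ vs)" and psd: "partial_sums_distinct_mod m (us @ vs)"
  shows "partial_sums_distinct_mod m (vs @ us)"
proof -
  have no_zero: "\<not> m dvd sum_list ys" if "us @ vs = xs @ ys @ zs" "ys \<noteq> []" "xs @ zs \<noteq> []" for xs ys zs
    using that psd dvd partial_sums_distinct_mod_iff by blast
  have "\<not> m dvd sum_list ys" if eq: "vs @ us = xs @ ys @ zs" and ne: "ys \<noteq> []" "xs @ zs \<noteq> []" for xs ys zs
  proof -
    consider (right) ws where "xs = vs @ ws" "us = ws @ ys @ zs"
      | (left) ws where "vs = xs @ ys @ ws" "zs = ws @ us"
      | (across) vs' us' where "vs = xs @ vs'" "us = us' @ zs" "ys = vs' @ us'"
      using eq by (auto simp: append_eq_append_conv2)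
    then show ?thesis
    proof cases
      case right
      then show ?thesis using no_zero[of ws ys "zs @ vs"] ne by auto
    next
      case left
      then show ?thesis using no_zero[of "us @ xs" ys ws] ne by auto
    next
      case across
      text \<open>A segment across the seam has as complement a segment of the original list.\<close>
      have "\<not> m dvd sum_list (zs @ xs)"
        using no_zero[of us' "zs @ xs" vs'] ne across by auto
      moreover have "m dvd sum_list ys + sum_list (zs @ xs)"
        using dvd across by (simp add: algebra_simps)
      ultimately show ?thesis
        by (metis dvd_add_right_iff)
    qed
  qed
  moreover have "m dvd sum_list (vs @ us)"
    using dvd by (simp add: add.commute)
  ultimately show ?thesis
    by (subst partial_sums_distinct_mod_iff) auto
qed

lemma sum_list_rotate: "sum_list (rotate k as) = sum_list (as :: int list)"
  by (metis add.commute append_take_drop_id rotate_drop_take sum_list_append)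

lemma partial_sums_distinct_mod_rotate:
  assumes "m dvd sum_list as" "partial_sums_distinct_mod m as"
  shows "partial_sums_distinct_mod m (rotate k as)"
  using assms partial_sums_distinct_mod_append_commute
      [of m "take (k mod length as) as" "drop (k mod length as) as"]
  by (simp only: rotate_drop_take append_take_drop_id)

lemma partial_sums_distinct_mod_map_upt:
  "partial_sums_distinct_mod m (map e [0..<k]) \<longleftrightarrow>
    (\<forall>i<k. \<forall>i'<k. i \<noteq> i' \<longrightarrow> \<not> [(\<Sum>j\<le>i. e j) = (\<Sum>j\<le>i'. e j)] (mod m))"
proof -
  have "(\<Sum>j\<le>i. map e [0..<k] ! j) = (\<Sum>j\<le>i. e j)" if "i < k" for i
    using that by (intro sum.cong) auto
  then show ?thesis
    by (simp add: partial_sums_distinct_mod_def)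
qed

section \<open>Rows and columns of banded arrays\<close>

lemma map_filter_append: "List.map_filter g (xs @ ys) = List.map_filter g xs @ List.map_filter g ys"
  by (simp add: List.map_filter_def)

lemma map_filter_cong:
  "(\<And>x. x \<in> set xs \<Longrightarrow> f x = g x) \<Longrightarrow> List.map_filter f xs = List.map_filter g xs"
  by (induction xs) (auto simp: List.map_filter_def)

lemma map_filter_rev: "List.map_filter g (rev xs) = rev (List.map_filter g xs)"
  by (simp add: List.map_filter_def rev_map rev_filter)

lemma map_filter_map: "List.map_filter g (map h xs) = List.map_filter (\<lambda>x. g (h x)) xs"
  by (simp add: List.map_filter_def filter_map comp_def)

lemma map_filter_rotate: "\<exists>j. List.map_filter g (rotate k xs) = rotate j (List.map_filter g xs)"
proof -
  let ?us = "take (k mod length xs) xs" and ?vs = "drop (k mod length xs) xs"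
  have "List.map_filter g (rotate k xs) = List.map_filter g ?vs @ List.map_filter g ?us"
    by (simp add: rotate_drop_take map_filter_append)
  also have "\<dots> = rotate (length (List.map_filter g ?us)) (List.map_filter g ?us @ List.map_filter g ?vs)"
    by (simp add: rotate_append)
  also have "List.map_filter g ?us @ List.map_filter g ?vs = List.map_filter g xs"
    by (simp flip: map_filter_append)
  finally show ?thesis by blast
qed

lemma map_filter_upt_band:
  assumes "k \<le> n"
  shows "List.map_filter (\<lambda>d. if d < k then Some (e d) else None) [0..<n] = map e [0..<k]"
proof -
  have "[0..<n] = [0..<k] @ [k..<n]"
    using assms by (metis le_add_diff_inverse upt_add_eq_append zero_le)
  moreover have "filter (\<lambda>d. d < k) [0..<k] = [0..<k]" "filter (\<lambda>d. d < k) [k..<n] = []"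
    by (auto simp: filter_id_conv filter_empty_conv)
  ultimately show ?thesis
    by (simp add: List.map_filter_def if_distrib comp_def cong: if_cong)
qed

text \<open>With \<open>e\<close> indexed by diagonal and row, moving along a row changes only the
  first argument. The summand \<open>n\<close> keeps \<open>r - c\<close> from truncating.\<close>

definition banded :: "nat \<Rightarrow> nat \<Rightarrow> (nat \<Rightarrow> nat \<Rightarrow> int) \<Rightarrow> parray" where
  "banded n k e r c = (let d = (r + n - c) mod n in if d < k then Some (e d r) else None)"

lemma mod_diff_diff:
  fixes d n r :: nat
  shows "\<lbrakk>d < n; r < n\<rbrakk> \<Longrightarrow> (r + n - (r + n - d) mod n) mod n = d"
  by (auto simp: mod_if)

lemma mod_add_diff:
  fixes c n r :: nat
  shows "\<lbrakk>c < n; r < n\<rbrakk> \<Longrightarrow> (c + (r + n - c) mod n) mod n = r"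
  by (simp add: mod_add_right_eq)

lemma mod_diff_add:
  fixes c d n :: nat
  shows "\<lbrakk>c < n; d < n\<rbrakk> \<Longrightarrow> ((c + d) mod n + n - c) mod n = d"
  by (auto simp: mod_if)

lemma col_entries_banded:
  assumes "k \<le> n" "c < n"
  shows "\<exists>j. col_entries n (banded n k e) c = rotate j (map (\<lambda>d. e d ((c + d) mod n)) [0..<k])"
proof -
  let ?g = "\<lambda>d. if d < k then Some (e d ((c + d) mod n)) else None"
  have "banded n k e r c = ?g ((r + n - c) mod n)" if "r < n" for r
  proof -
    have "(c + (r + n - c) mod n) mod n = r"
      using that assms by (simp add: mod_add_diff)
    then show ?thesis by (simp add: banded_def Let_def)
  qed
  then have "col_entries n (banded n k e) c = List.map_filter (\<lambda>r. ?g ((r + n - c) mod n)) [0..<n]"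
    unfolding col_entries_def by (intro map_filter_cong) auto
  also have "\<dots> = List.map_filter ?g (map (\<lambda>r. (r + n - c) mod n) [0..<n])"
    by (rule map_filter_map[symmetric])
  \<comment> \<open>Going down column \<open>c\<close>, the diagonal index rises cyclically by 1,
    starting at \<open>(n - c) mod n\<close>.\<close>
  also have "map (\<lambda>r. (r + n - c) mod n) [0..<n] = rotate (n - c) [0..<n]"
    using assms by (intro nth_equalityI) (auto simp: nth_rotate add.commute)
  finally show ?thesis
    using map_filter_rotate[of ?g "n - c" "[0..<n]"] map_filter_upt_band[OF assms(1)] by metis
qed

lemma row_entries_banded:
  assumes "k \<le> n" "r < n"
  shows "\<exists>j. row_entries n (banded n k e) r = rev (rotate j (map (\<lambda>d. e d r) [0..<k]))"
proof -
  let ?g = "\<lambda>d. if d < k then Some (e d r) else None"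
  have "row_entries n (banded n k e) r = List.map_filter ?g (map (\<lambda>c. (r + n - c) mod n) [0..<n])"
    by (simp add: row_entries_def map_filter_map banded_def Let_def)
  \<comment> \<open>Going right in row \<open>r\<close>, the diagonal index falls cyclically from
    \<open>r\<close>, hence the reversal.\<close>
  also have "map (\<lambda>c. (r + n - c) mod n) [0..<n] = rev (rotate (r + 1) [0..<n])"
    using assms by (intro nth_equalityI) (auto simp: nth_rotate rev_nth Suc_diff_Suc simp del: rotate_Suc)
  finally show ?thesis
    using map_filter_rotate[of ?g "r + 1" "[0..<n]"] map_filter_upt_band[OF assms(1)]
    by (metis map_filter_rev)
qed

lemma card_row_banded:
  assumes "k \<le> n" "r < n"
  shows "card {c. c < n \<and> banded n k e r c \<noteq> None} = k"
proof -
  have "bij_betw (\<lambda>c. (r + n - c) mod n) {c. c < n \<and> banded n k e r c \<noteq> None} {..<k}"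
    by (rule bij_betw_byWitness[where f' = "\<lambda>d. (r + n - d) mod n"])
      (use assms in \<open>auto simp: banded_def Let_def mod_diff_diff mod_add_diff mod_diff_add split: if_splits\<close>)
  then show ?thesis
    using bij_betw_same_card by fastforce
qed

lemma card_col_banded:
  assumes "k \<le> n" "c < n"
  shows "card {r. r < n \<and> banded n k e r c \<noteq> None} = k"
proof -
  have "bij_betw (\<lambda>r. (r + n - c) mod n) {r. r < n \<and> banded n k e r c \<noteq> None} {..<k}"
    by (rule bij_betw_byWitness[where f' = "\<lambda>d. (c + d) mod n"])
      (use assms in \<open>auto simp: banded_def Let_def mod_diff_diff mod_add_diff mod_diff_add split: if_splits\<close>)
  then show ?thesis
    using bij_betw_same_card by fastforce
qed

lemma appears_in_banded:
  assumes "k \<le> n" "d < k" "r < n"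
  shows "appears_in n (banded n k e) (e d r)"
proof -
  let ?c = "(r + n - d) mod n"
  have "?c < n" "(r + n - ?c) mod n = d"
    using assms by (auto simp: mod_diff_diff)
  then show ?thesis
    using assms unfolding appears_in_def banded_def
    by (intro exI[of _ r] conjI exI[of _ "?c"]) auto
qed

section \<open>The construction\<close>

text \<open>
  The \<open>k\<close>-th smallest lower member when \<open>{0..<4 * p} - {0, 2 * p - 1}\<close> is split into pairs of
  consecutive numbers.
\<close>

definition low :: "nat \<Rightarrow> nat \<Rightarrow> nat" where
  "low p k = (if k + 1 < p then 2 * k + 1 else 2 * k + 2)"

text \<open>
  Positive pairs of diagonals take the pairs \<open>low p 0, low p 2, \<dots>\<close> in increasing order, negative
  ones the pairs \<open>low p 1, low p 3, \<dots>\<close> in decreasing order. This keeps the sums inside the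
  pairs distinct.
\<close>

definition base :: "nat \<Rightarrow> nat \<Rightarrow> nat" where
  "base p d =
    (if d = 4 * p - 2 then 0
     else if d = 4 * p - 1 then 2 * p - 1
     else if d mod 4 < 2 then low p (d div 2) + d mod 2
     else low p (2 * p - 2 - d div 2) + (1 - d mod 2))"

text \<open>The summand \<open>n\<close> only keeps the truncated subtraction \<open>r - d mod 2\<close> from hitting \<open>0\<close>.\<close>

definition entry :: "nat \<Rightarrow> nat \<Rightarrow> nat \<Rightarrow> nat \<Rightarrow> int" where
  "entry p n d r =
    (if d mod 4 \<in> {0, 3} then 1 else - 1) *
    (1 + int n * int (base p d) + int ((r + n - d mod 2) mod n))"

lemma mod_4:
  fixes i :: nat
  shows "(4 * i) mod 4 = 0" "(4 * i + 1) mod 4 = 1" "(4 * i + 2) mod 4 = 2" "(4 * i + 3) mod 4 = 3"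
    and "(4 * i) mod 2 = 0" "(4 * i + 1) mod 2 = 1" "(4 * i + 2) mod 2 = 0" "(4 * i + 3) mod 2 = 1"
  by presburger+

lemma base_4:
  assumes "i < p"
  shows "base p (4 * i) = low p (2 * i)"
    and "base p (4 * i + 1) = low p (2 * i) + 1"
    and "i + 1 < p \<Longrightarrow> base p (4 * i + 2) = low p (2 * p - 3 - 2 * i) + 1"
    and "i + 1 < p \<Longrightarrow> base p (4 * i + 3) = low p (2 * p - 3 - 2 * i)"
    and "i + 1 = p \<Longrightarrow> base p (4 * i + 2) = 0"
    and "i + 1 = p \<Longrightarrow> base p (4 * i + 3) = 2 * p - 1"
proof -
  note m = mod_4[of i]
  have m': "(4 * i) div 2 = 2 * i" "(4 * i + 1) div 2 = 2 * i"
    "(4 * i + 2) div 2 = 2 * i + 1" "(4 * i + 3) div 2 = 2 * i + 1"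
    by presburger+
  show "base p (4 * i) = low p (2 * i)" "base p (4 * i + 1) = low p (2 * i) + 1"
    using assms unfolding base_def m m' by (auto; presburger)+
  have "2 * p - 2 - (2 * i + 1) = 2 * p - 3 - 2 * i" by simp
  then show "i + 1 < p \<Longrightarrow> base p (4 * i + 2) = low p (2 * p - 3 - 2 * i) + 1"
     "i + 1 < p \<Longrightarrow> base p (4 * i + 3) = low p (2 * p - 3 - 2 * i)"
    unfolding base_def m m' by auto
  show "i + 1 = p \<Longrightarrow> base p (4 * i + 2) = 0" "i + 1 = p \<Longrightarrow> base p (4 * i + 3) = 2 * p - 1"
    unfolding base_def by auto
qed

text \<open>Ensures that each block of \<open>n\<close> consecutive absolute values is carried by
  some diagonal.\<close>

lemma base_surj:
  assumes "z < 4 * p"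
  shows "\<exists>d<4 * p. base p d = z"
proof -
  \<comment> \<open>Pairs with even \<open>k\<close> sit on positive pairs of diagonals, those with
    odd \<open>k\<close> on negative ones, where the upper member comes first.\<close>
  have low_base: "\<exists>d<4 * p. base p d = low p k + q" if k: "k \<le> 2 * p - 2" and q: "q < 2" for k q
  proof (cases "even k")
    case True
    then obtain i where i: "k = 2 * i" by blast
    then have "i < p" using k assms by simp
    then show ?thesis
      using base_4(1,2)[of i p] q i
      by (intro exI[of _ "4 * i + q"]) (auto simp: less_2_cases_iff)
  next
    case False
    then obtain j where j: "k = 2 * j + 1" by (rule oddE)
    \<comment> \<open>Solves \<open>2 * p - 3 - 2 * i = 2 * j + 1\<close>.\<close>
    define i where "i = p - 2 - j"
    have "j + 2 \<le> p" using j k by linarith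
    then have i: "i + 1 < p" "2 * p - 3 - 2 * i = k"
      using j by (auto simp: i_def)
    then show ?thesis
      using base_4(3,4)[of i p] q
      by (intro exI[of _ "4 * i + 3 - q"]) (auto simp: less_2_cases_iff)
  qed
  consider "z = 0" | "z = 2 * p - 1" | "0 < z" "z < 2 * p - 1" | "2 * p \<le> z"
    by linarith
  then show ?thesis
  proof cases
    case 1
    then show ?thesis using assms by (intro exI[of _ "4 * p - 2"]) (auto simp: base_def)
  next
    case 2
    then show ?thesis using assms by (intro exI[of _ "4 * p - 1"]) (auto simp: base_def)
  next
    case 3
    \<comment> \<open>Between the omitted numbers 0 and \<open>2 * p - 1\<close> the lower members
      are odd; beyond them, in the next case, they are even.\<close>
    have "z = low p ((z - 1) div 2) + (z - 1) mod 2"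
      using 3 div_mult_mod_eq[of "z - 1" 2] unfolding low_def by auto
    moreover have "(z - 1) div 2 \<le> 2 * p - 2" using 3 by simp
    ultimately show ?thesis using low_base[of "(z - 1) div 2" "(z - 1) mod 2"] by simp
  next
    case 4
    have "2 \<le> z" using 4 assms by (cases p) auto
    then have "(z - 2) mod 2 = z mod 2"
      by (simp add: le_mod_geq)
    then have "z = low p ((z - 2) div 2) + z mod 2"
      using 4 \<open>2 \<le> z\<close> div_mult_mod_eq[of "z - 2" 2] unfolding low_def by auto linarith
    moreover have "(z - 2) div 2 \<le> 2 * p - 2" using assms by simp
    ultimately show ?thesis using low_base[of "(z - 2) div 2" "z mod 2"] by simp
  qed
qed

section \<open>Partial sums of the construction\<close>

text \<open>
  Common form of a row and a column: \<open>g\<close> is \<open>0\<close> for columns, \<open>1\<close> for rows, and \<open>1 - N\<close> for row \<open>0\<close>,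
  where the shift wraps around.
\<close>

locale band_line =
  fixes p :: nat and N g :: int and e :: "nat \<Rightarrow> int" and X X' Y Y' :: "nat \<Rightarrow> int"
  assumes p: "p > 0" and N: "N > 1"
    and X: "\<And>i. 0 \<le> X i" "\<And>i. X i < N" and X': "\<And>i. X i - X' i = g"
    and Y: "\<And>i. 0 \<le> Y i" "\<And>i. Y i < N" and Y': "\<And>i. Y i - Y' i = g"
    and Y'_range: "\<And>i. 0 \<le> Y' i" "\<And>i. Y' i < N"
    and g: "g \<in> {0, 1, 1 - N}"
    and e: "\<And>i. i < p \<Longrightarrow> e (4 * i) = 1 + N * int (base p (4 * i)) + X i"
      "\<And>i. i < p \<Longrightarrow> e (4 * i + 1) = - (1 + N * int (base p (4 * i + 1)) + X' i)"
      "\<And>i. i < p \<Longrightarrow> e (4 * i + 2) = - (1 + N * int (base p (4 * i + 2)) + Y i)"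
      "\<And>i. i < p \<Longrightarrow> e (4 * i + 3) = 1 + N * int (base p (4 * i + 3)) + Y' i"
begin

text \<open>The sum of the first \<open>i\<close> blocks of four in units of \<open>N\<close>; the
  last block resets it to 0.\<close>

definition s :: "nat \<Rightarrow> int" where
  "s i = (if i < p then - 2 * int i else 0)"

text \<open>In a block the offsets give \<open>g - g = 0\<close>. The bases give -2, except in the
  last block, where they give \<open>2 * p - 2\<close>.\<close>

lemma sum_lessThan_4: "i \<le> p \<Longrightarrow> (\<Sum>j<4 * i. e j) = N * s i"
proof (induction i)
  case 0
  then show ?case using p by (simp add: s_def)
next
  case (Suc i)
  have "4 * Suc i = Suc (Suc (Suc (Suc (4 * i))))" by simp
  then have "(\<Sum>j<4 * Suc i. e j) =
      (\<Sum>j<4 * i. e j) + e (4 * i) + e (4 * i + 1) + e (4 * i + 2) + e (4 * i + 3)"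
    by (simp only: sum.lessThan_Suc) (simp add: numeral_eq_Suc)
  also have "\<dots> = N * s i + N * (int (base p (4 * i)) - int (base p (4 * i + 1))
      - int (base p (4 * i + 2)) + int (base p (4 * i + 3)))"
    using e[of i] Suc X'[of i] Y'[of i] by (simp add: algebra_simps)
  also have "\<dots> = N * s (Suc i)"
  proof (cases "i + 1 = p")
    case True
    then show ?thesis
      using base_4[of i p] by (auto simp: s_def of_nat_diff algebra_simps)
  next
    case False
    then show ?thesis
      using Suc.prems base_4[of i p] by (simp add: s_def algebra_simps)
  qed
  finally show ?case .
qed

text \<open>The coefficient of \<open>N\<close> in the sum inside the negative pair of block
  \<open>i\<close>; the remainder is \<open>- w i\<close>.\<close>

definition v :: "nat \<Rightarrow> int" where
  "v i = (if i + 1 < p then - 2 * int i - 2 - int (low p (2 * p - 3 - 2 * i)) else 1 - 2 * int p)"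

definition w :: "nat \<Rightarrow> int" where
  "w i = 1 + Y i - g"

text \<open>Since \<open>Y i - g = Y' i\<close>, \<open>w i\<close> is \<open>1 + Y' i\<close>, so
  the bounds hold even when the shift wraps around.\<close>

lemma w_range: "1 \<le> w i" "w i \<le> N"
  using g N Y[of i] Y'_range[of i] Y'[of i] by (auto simp: w_def)

definition S :: "nat \<Rightarrow> int" where
  "S d = (\<Sum>j\<le>d. e j)"

lemma S_4:
  assumes "i < p"
  shows "S (4 * i) = N * (int (low p (2 * i)) - 2 * int i) + (1 + X i)"
    and "S (4 * i + 1) = N * (- 2 * int i - 1) + g"
    and "S (4 * i + 2) = N * v i - w i"
    and "S (4 * i + 3) = N * s (Suc i)"
proof -
  have sum: "(\<Sum>j<4 * i. e j) = N * (- 2 * int i)"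
    using assms sum_lessThan_4[of i] by (simp add: s_def)
  show 0: "S (4 * i) = N * (int (low p (2 * i)) - 2 * int i) + (1 + X i)"
    using assms sum e(1)[of i] base_4(1)[of i p]
    by (simp add: S_def lessThan_Suc_atMost[symmetric] algebra_simps)
  show 1: "S (4 * i + 1) = N * (- 2 * int i - 1) + g"
    using assms 0 e(2)[of i] base_4(2)[of i p] X'[of i] by (simp add: S_def algebra_simps)
  show "S (4 * i + 2) = N * v i - w i"
    using assms 1 e(3)[of i] base_4(3,5)[of i p]
    by (cases "i + 1 = p") (auto simp: S_def v_def w_def algebra_simps)
  have "{..4 * i + 3} = {..<4 * Suc i}" by auto
  then show "S (4 * i + 3) = N * s (Suc i)"
    using assms sum_lessThan_4[of "Suc i"] by (simp add: S_def)
qed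

text \<open>The remainders differ by a multiple of \<open>N\<close> smaller than \<open>N\<close>.
  This lets equal sums be compared through their coefficients.\<close>

lemma mult_N_cancel:
  assumes "N * a + b = N * a' + b'" "\<bar>b - b'\<bar> < N"
  shows "a = a' \<and> b = b'"
proof -
  have "N dvd b' - b"
    using assms(1) by (intro dvdI[of _ _ "a - a'"]) (simp add: algebra_simps)
  then have "b = b'"
    using assms(2) dvd_imp_le_int[of "b' - b" N] by force
  then show ?thesis using assms(1) N by simp
qed

lemma mult_N_mono: "a \<le> b \<Longrightarrow> N * a \<le> N * b"
  using N by (simp add: mult_left_mono)

text \<open>The thresholds 0 and \<open>- (2 * int p * N)\<close> separate the sums inside positive
  pairs, after pairs, and inside negative pairs. In the last block the base 0 makes the drop too
  small to pass the lower threshold.\<close>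

lemma sum_bounds:
  assumes "i < p"
  shows "1 \<le> S (4 * i)" "S (4 * i) \<le> N * (2 * int p + 1)"
    and "- (2 * int p * N) < S (4 * i + 1)" "S (4 * i + 1) \<le> 0"
    and "- (2 * int p * N) < S (4 * i + 3)" "S (4 * i + 3) \<le> 0"
    and "- (4 * int p * N) \<le> S (4 * i + 2)" "S (4 * i + 2) < 0"
    and "i + 1 < p \<Longrightarrow> S (4 * i + 2) < - (2 * int p * N)"
proof -
  note S = S_4[OF assms]
  have "0 \<le> int (low p (2 * i)) - 2 * int i" "int (low p (2 * i)) - 2 * int i \<le> 2 * int p"
    using assms by (auto simp: low_def)
  then have "0 \<le> N * (int (low p (2 * i)) - 2 * int i)"
      "N * (int (low p (2 * i)) - 2 * int i) \<le> N * (2 * int p)"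
    using N by (auto intro: mult_N_mono)
  then show "1 \<le> S (4 * i)" "S (4 * i) \<le> N * (2 * int p + 1)"
    unfolding S distrib_left using X[of i] by linarith+
  have "1 - 2 * int p \<le> - 2 * int i - 1" "- 2 * int i - 1 \<le> - 1"
    using assms by auto
  then have "N * (1 - 2 * int p) \<le> N * (- 2 * int i - 1)" "N * (- 2 * int i - 1) \<le> N * (- 1)"
    by (blast intro: mult_N_mono)+
  moreover have "N * (1 - 2 * int p) = N - 2 * int p * N" "N * (- 1) = - N"
    by (simp_all add: algebra_simps)
  \<comment> \<open>The extreme \<open>g = 1 - N\<close> leaves the lower bound strict by 1;
    \<open>g = 1\<close> is absorbed by \<open>- N\<close>.\<close>
  ultimately show "- (2 * int p * N) < S (4 * i + 1)" "S (4 * i + 1) \<le> 0"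
    unfolding S using g N by (auto simp del: mult_le_cancel_left mult_le_cancel_left_pos)
  have "1 - 2 * int p \<le> s (Suc i)" "s (Suc i) \<le> 0"
    using assms by (auto simp: s_def)
  from this[THEN mult_N_mono] show "- (2 * int p * N) < S (4 * i + 3)" "S (4 * i + 3) \<le> 0"
    unfolding S using N by (auto simp: algebra_simps)
  have "1 - 4 * int p \<le> v i" "v i \<le> 0"
    using assms p by (auto simp: v_def low_def)
  from this[THEN mult_N_mono] show "- (4 * int p * N) \<le> S (4 * i + 2)" "S (4 * i + 2) < 0"
    unfolding S using w_range[of i] by (auto simp: algebra_simps)
  assume "i + 1 < p"
  then have "v i \<le> - 2 * int p"
    by (auto simp: v_def low_def)
  from mult_N_mono[OF this] show "S (4 * i + 2) < - (2 * int p * N)"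
    unfolding S using w_range[of i] by (auto simp: algebra_simps)
qed

section \<open>Distinctness of the partial sums\<close>

lemma inj_S_0:
  assumes "i < p" "i' < p" "S (4 * i) = S (4 * i')"
  shows "i = i'"
proof -
  \<comment> \<open>This coefficient is \<open>2 * i + 1\<close>, for larger \<open>i\<close>
    \<open>2 * i + 2\<close>, hence strictly increasing.\<close>
  have "int (low p (2 * i)) - 2 * int i = int (low p (2 * i')) - 2 * int i'"
    using mult_N_cancel[OF assms(3)[unfolded S_4(1)[OF assms(1)] S_4(1)[OF assms(2)]]]
      X[of i] X[of i'] by (simp add: abs_less_iff)
  then show ?thesis
    unfolding low_def by (simp split: if_splits; linarith)
qed

lemma inj_S_1: "\<lbrakk>i < p; i' < p; S (4 * i + 1) = S (4 * i' + 1)\<rbrakk> \<Longrightarrow> i = i'"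
  using N unfolding S_4 by auto

text \<open>\<open>v\<close> is strictly increasing: \<open>2 * i + 2 - 4 * p\<close>, later
  \<open>2 * i + 3 - 4 * p\<close>, and finally \<open>1 - 2 * p\<close>.\<close>

lemma inj_S_2:
  assumes "i < p" "i' < p" "S (4 * i + 2) = S (4 * i' + 2)"
  shows "i = i'"
proof -
  have "v i = v i'"
    using assms mult_N_cancel[of "v i" "- w i" "v i'" "- w i'"] w_range[of i] w_range[of i']
    unfolding S_4(3)[OF assms(1)] S_4(3)[OF assms(2)] by auto
  then show ?thesis
    using assms(1,2) by (auto simp: v_def low_def split: if_splits)
qed

lemma inj_S_3:
  assumes "i < p" "i' < p" "S (4 * i + 3) = S (4 * i' + 3)"
  shows "i = i'"
proof -
  have "s (Suc i) = s (Suc i')"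
    using assms N by (simp add: S_4)
  then show ?thesis
    using assms(1,2) by (auto simp: s_def split: if_splits)
qed

text \<open>The sum after a negative pair is an even multiple of \<open>N\<close>. Equality would
  force \<open>N dvd g\<close>, so \<open>g = 0\<close>, and then an odd coefficient would equal an
  even one.\<close>

lemma S_1_neq_S_3:
  assumes "i < p" "i' < p"
  shows "S (4 * i + 1) \<noteq> S (4 * i' + 3)"
proof
  assume "S (4 * i + 1) = S (4 * i' + 3)"
  then have eq: "N * (- 2 * int i - 1) + g = N * s (Suc i')"
    using assms unfolding S_4(2)[OF assms(1)] S_4(4)[OF assms(2)] by simp
  then have "N dvd g"
    by (metis dvd_add_right_iff dvd_triv_left)
  moreover have "\<not> N dvd 1" "\<not> N dvd 1 - N"
    using N by (auto simp: dvd_diff_left_iff)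
  ultimately have "g = 0"
    using g by auto
  then have "- 2 * int i - 1 = s (Suc i')"
    using eq N by simp
  moreover have "even (s (Suc i'))" by (simp add: s_def)
  ultimately show False by presburger
qed

lemma S_2_neq:
  assumes "i < p" "i' < p"
  shows "S (4 * i + 2) \<noteq> S (4 * i' + 1)" "S (4 * i + 2) \<noteq> S (4 * i' + 3)"
proof -
  have "S (4 * i + 2) \<noteq> S (4 * i' + 1) \<and> S (4 * i + 2) \<noteq> S (4 * i' + 3)"
  proof (cases "i + 1 = p")
    case False
    then show ?thesis
      using sum_bounds(9)[of i] sum_bounds(3,5)[of i'] assms by auto
  next
    case True
    have S2: "S (4 * i + 2) = N * (1 - 2 * int p) - w i"
      using S_4(3)[OF assms(1)] True by (simp add: v_def)
    have "2 - 2 * int p \<le> s (Suc i')"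
      using assms by (auto simp: s_def)
    from mult_N_mono[OF this] have "S (4 * i + 2) < S (4 * i' + 3)"
      unfolding S2 S_4(4)[OF assms(2)] using w_range[of i] N by (simp add: algebra_simps)
    moreover have "S (4 * i + 2) < S (4 * i' + 1)"
    \<comment> \<open>For \<open>i' = i\<close> both coefficients are \<open>1 - 2 * p\<close> and
      decide nothing, but the sums differ by one negative entry. Otherwise the coefficients are at
      least 2 apart, which outweighs \<open>g\<close>.\<close>
    proof (cases "i' = i")
      case True
      then show ?thesis
        using e(3)[of i] assms Y[of i] N \<open>i + 1 = p\<close> base_4(5)[of i p] by (simp add: S_def)
    next
      case False
      then have "3 - 2 * int p \<le> - 2 * int i' - 1"
        using assms True by auto
      from mult_N_mono[OF this] show ?thesis
        unfolding S2 S_4(2)[OF assms(2)] using w_range[of i] N g by (auto simp: algebra_simps)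
    qed
    ultimately show ?thesis by auto
  qed
  then show "S (4 * i + 2) \<noteq> S (4 * i' + 1)" "S (4 * i + 2) \<noteq> S (4 * i' + 3)"
    by auto
qed

lemma block_cases:
  "d < 4 * p \<Longrightarrow> \<exists>i<p. d = 4 * i \<or> d = 4 * i + 1 \<or> d = 4 * i + 2 \<or> d = 4 * i + 3"
  by presburger

lemma inj_on_S: "inj_on S {..<4 * p}"
proof (rule inj_onI)
  fix d d' assume d: "d \<in> {..<4 * p}" "d' \<in> {..<4 * p}" and eq: "S d = S d'"
  obtain i i' where i: "i < p" "i' < p"
    and d_i: "d = 4 * i \<or> d = 4 * i + 1 \<or> d = 4 * i + 2 \<or> d = 4 * i + 3"
    and d'_i': "d' = 4 * i' \<or> d' = 4 * i' + 1 \<or> d' = 4 * i' + 2 \<or> d' = 4 * i' + 3"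
    using block_cases[of d] block_cases[of d'] d by auto
  have S_0_neq: "S (4 * i) \<noteq> S (4 * i' + 1) \<and> S (4 * i) \<noteq> S (4 * i' + 2) \<and> S (4 * i) \<noteq> S (4 * i' + 3)"
    if "i < p" "i' < p" for i i'
    using sum_bounds(1)[OF that(1)] sum_bounds(4,6,8)[OF that(2)] by linarith
  from d_i d'_i' show "d = d'"
    by (elim disjE)
      (use i eq inj_S_0 inj_S_1 inj_S_2 inj_S_3 S_0_neq S_1_neq_S_3 S_2_neq in metis)+
qed

lemma S_range:
  assumes "d < 4 * p"
  shows "- (4 * int p * N) \<le> S d" "S d \<le> N * (2 * int p + 1)"
proof -
  have "0 \<le> int p * N" using N by simp
  obtain i where "i < p" "d = 4 * i \<or> d = 4 * i + 1 \<or> d = 4 * i + 2 \<or> d = 4 * i + 3"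
    using block_cases assms by blast
  then have "- (4 * int p * N) \<le> S d \<and> S d \<le> N * (2 * int p + 1)"
    using sum_bounds(1-8)[of i] \<open>0 \<le> int p * N\<close> N by (auto simp: algebra_simps)
  then show "- (4 * int p * N) \<le> S d" "S d \<le> N * (2 * int p + 1)"
    by auto
qed

lemma sum_list_eq_0: "sum_list (map e [0..<4 * p]) = 0"
  using sum_lessThan_4[of p] by (simp add: s_def interv_sum_list_conv_sum_set_nat atLeast0LessThan)

lemma partial_sums_distinct: "partial_sums_distinct_mod (2 * N * int (4 * p) + 1) (map e [0..<4 * p])"
proof -
  have "d = d'" if d: "d < 4 * p" "d' < 4 * p" and cong: "[S d = S d'] (mod (2 * N * int (4 * p) + 1))" for d d'
  proof -
    \<comment> \<open>In terms of \<open>q\<close> the window has width \<open>6 * q + N\<close>, at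
      most \<open>7 * q\<close>, against the modulus \<open>8 * q + 1\<close>.\<close>
    define q where "q = N * int p"
    have "N \<le> q" using p N by (simp add: q_def)
    moreover have "- 4 * q \<le> S x" "S x \<le> 2 * q + N" if "x < 4 * p" for x
      using S_range[OF that] by (simp_all add: q_def algebra_simps)
    from this[OF d(1)] this[OF d(2)] have "- 4 * q \<le> S d" "S d \<le> 2 * q + N"
      "- 4 * q \<le> S d'" "S d' \<le> 2 * q + N" .
    ultimately have "\<bar>S d - S d'\<bar> < 8 * q + 1"
      using N by linarith
    moreover have "2 * N * int (4 * p) + 1 = 8 * q + 1"
      by (simp add: q_def)
    ultimately have "\<bar>S d - S d'\<bar> < 2 * N * int (4 * p) + 1"
      by simp
    then have "S d = S d'"
      using cong dvd_imp_le_int[of "S d - S d'" "2 * N * int (4 * p) + 1"]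
      by (force simp: cong_iff_dvd_diff)
    then show ?thesis
      using inj_on_S d by (auto dest: inj_onD)
  qed
  then show ?thesis
    unfolding partial_sums_distinct_mod_map_upt S_def by blast
qed

end

section \<open>Rows and columns as band lines, and assembly of the array\<close>

lemma row_band_line:
  assumes "p > 0" "n > 1" "r < n"
  shows "band_line p (int n) (if r = 0 then 1 - int n else 1) (\<lambda>d. entry p n d r)
    (\<lambda>_. int r) (\<lambda>_. int ((r + n - 1) mod n)) (\<lambda>_. int r) (\<lambda>_. int ((r + n - 1) mod n))"
proof unfold_locales
  have r: "(r + n - 1) mod n = (if r = 0 then n - 1 else r - 1)"
    using assms by (auto simp: mod_if)
  fix i
  show "int r - int ((r + n - 1) mod n) = (if r = 0 then 1 - int n else 1)"
    unfolding r using assms by (auto simp: of_nat_diff)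
  show "entry p n (4 * i) r = 1 + int n * int (base p (4 * i)) + int r"
    "entry p n (4 * i + 1) r =
      - (1 + int n * int (base p (4 * i + 1)) + int ((r + n - 1) mod n))"
    "entry p n (4 * i + 2) r = - (1 + int n * int (base p (4 * i + 2)) + int r)"
    "entry p n (4 * i + 3) r =
      1 + int n * int (base p (4 * i + 3)) + int ((r + n - 1) mod n)"
    unfolding entry_def mod_4 using assms by simp_all
qed (use assms in auto)

text \<open>The next diagonal meets the column one row further down, and the shift on odd diagonals
  undoes this step; both members of a pair get the same offset and \<open>g = 0\<close>.\<close>

lemma col_band_line:
  assumes "p > 0" "n > 1"
  shows "band_line p (int n) 0 (\<lambda>d. entry p n d ((c + d) mod n))
    (\<lambda>i. int ((c + 4 * i) mod n)) (\<lambda>i. int ((c + 4 * i) mod n))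
    (\<lambda>i. int ((c + 4 * i + 2) mod n)) (\<lambda>i. int ((c + 4 * i + 2) mod n))"
proof unfold_locales
  fix i
  have pred: "(Suc x mod n + n - 1) mod n = x mod n" for x
    using assms by (auto simp: mod_Suc)
  show "entry p n (4 * i) ((c + 4 * i) mod n) =
      1 + int n * int (base p (4 * i)) + int ((c + 4 * i) mod n)"
    "entry p n (4 * i + 1) ((c + (4 * i + 1)) mod n) =
      - (1 + int n * int (base p (4 * i + 1)) + int ((c + 4 * i) mod n))"
    "entry p n (4 * i + 2) ((c + (4 * i + 2)) mod n) =
      - (1 + int n * int (base p (4 * i + 2)) + int ((c + 4 * i + 2) mod n))"
    "entry p n (4 * i + 3) ((c + (4 * i + 3)) mod n) =
      1 + int n * int (base p (4 * i + 3)) + int ((c + 4 * i + 2) mod n)"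
    unfolding entry_def mod_4 using pred[of "c + 4 * i"] pred[of "c + 4 * i + 2"]
    by (simp_all add: numeral_3_eq_3 add.assoc)
qed (use assms in auto)

lemma appears_in_entry:
  assumes "4 * p \<le> n" "n > 0" "1 \<le> x" "x \<le> int n * int (4 * p)"
  shows "appears_in n (banded n (4 * p) (entry p n)) x \<or> appears_in n (banded n (4 * p) (entry p n)) (- x)"
proof -
  define y where "y = nat (x - 1)"
  have x: "x = 1 + int y" and y: "y < n * (4 * p)"
    using assms unfolding y_def by (auto simp: nat_less_iff)
  then have "y div n < 4 * p"
    using assms(2) by (simp add: less_mult_imp_div_less mult.commute)
  then obtain d where d: "d < 4 * p" "base p d = y div n"
    using base_surj by blast
  \<comment> \<open>\<open>y div n\<close> selects the diagonal; the row inverts its shift so that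
    the offset becomes \<open>y mod n\<close>.\<close>
  define r where "r = (y mod n + d mod 2) mod n"
  have "r < n" using assms(2) by (simp add: r_def)
  have "(r + n - d mod 2) mod n = y mod n"
  proof -
    have "d mod 2 \<le> n" using assms(1) d by (meson le_trans less_imp_le mod_less_eq_dividend)
    then have "[r + n - d mod 2 + d mod 2 = y mod n + d mod 2] (mod n)"
      by (simp add: r_def cong_def)
    then show ?thesis
      unfolding cong_add_rcancel_nat by (simp add: cong_def)
  qed
  then have "\<bar>entry p n d r\<bar> = x"
    using d(2) by (simp add: entry_def x abs_mult flip: of_nat_mult of_nat_add)
  then show ?thesis
    using appears_in_banded[OF assms(1) d(1) \<open>r < n\<close>, of "entry p n"]
    by (metis abs_eq_iff abs_of_nonneg abs_ge_zero minus_minus)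
qed

theorem theorem1p4:
  fixes p n :: nat
  assumes "p > 0" and "n \<ge> 4 * p"
  shows "\<exists>A. integer_heffter_array n (4 * p) A \<and> globally_simple n (4 * p) A"
proof -
  let ?A = "banded n (4 * p) (entry p n)" and ?m = "2 * int n * int (4 * p) + 1"
  have n: "n > 1" using assms by simp
  have row: "sum_list (row_entries n ?A r) = 0 \<and> partial_sums_distinct_mod ?m (row_entries n ?A r)"
    if r: "r < n" for r
  proof -
    obtain j where "row_entries n ?A r = rev (rotate j (map (\<lambda>d. entry p n d r) [0..<4 * p]))"
      using row_entries_banded[OF assms(2) r] by blast
    then show ?thesis
      using band_line.sum_list_eq_0[OF row_band_line[OF assms(1) n r]]
        band_line.partial_sums_distinct[OF row_band_line[OF assms(1) n r]]
      by (metis dvd_0_right partial_sums_distinct_mod_rev partial_sums_distinct_mod_rotate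
          sum_list_rev sum_list_rotate)
  qed
  have col: "sum_list (col_entries n ?A c) = 0 \<and> partial_sums_distinct_mod ?m (col_entries n ?A c)"
    if c: "c < n" for c
  proof -
    obtain j where "col_entries n ?A c = rotate j (map (\<lambda>d. entry p n d ((c + d) mod n)) [0..<4 * p])"
      using col_entries_banded[OF assms(2) c] by blast
    then show ?thesis
      using band_line.sum_list_eq_0[OF col_band_line[OF assms(1) n]]
        band_line.partial_sums_distinct[OF col_band_line[OF assms(1) n]]
      by (metis dvd_0_right partial_sums_distinct_mod_rotate sum_list_rotate)
  qed
  have "integer_heffter_array n (4 * p) ?A"
    unfolding integer_heffter_array_def heffter_array_def
    using row col n card_row_banded[OF assms(2)] card_col_banded[OF assms(2)] appears_in_entry[OF assms(2)]
    by auto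
  moreover have "globally_simple n (4 * p) ?A"
    unfolding globally_simple_def using row col by blast
  ultimately show ?thesis by blast
qed

end
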